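(* Let $r$ be a rational number with $r\equiv 1 \pmod 5$. Then, for every integer $m\ge 0$, $$P_r(5m+4)\equiv 0 \pmod 5 .$$
   Context: Let $P(q)=\sum_{n=0}^\infty p(n)q^n=\prod_{k=1}^\infty \frac{1}{1-q^k}$ be the generating function of the number $p(n)$ of unordered partitions of $n$, viewed as a formal power series in $q$ with constant term $1$. For a rational number $r$, the rational numbers $P_r(n)$, $n\ge 0$, are defined by $$P(q)^r=\sum_{n=0}^\infty P_r(n)q^n,$$ where $P(q)^r$ is the usual rational power (with constant term $1$) of a formal power series with constant term $1$, i.e. $P(q)^r=\exp(r\log P(q))$. Convention on congruences: in congruences modulo $5$, a rational number $a/b$, with $a$ and $b$ relatively prime integers and $b$ not divisible by $5$, is understood as $a\cdot b^{-1}$, where $b^{-1}$ is the multiplicative inverse of $b$ modulo $5$. In particular, $r\equiv 1\pmod 5$ means that $r=a/b$ in lowest terms with $5\nmid b$ and $a\equiv b \pmod 5$; and $P_r(n)\equiv 0\pmod 5$ means that the rational number $P_r(n)$, in lowest terms, has denominator not divisible by $5$ and numerator divisible by $5$. *)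

theory Defs
  imports
    "HOL-Library.Multiset"
    "HOL-Computational_Algebra.Formal_Power_Series"
    "HOL-Number_Theory.Cong"
    "HOL-Number_Theory.Modular_Inverse"
begin

text \<open>A partition of \<open>n\<close> is a multiset of positive natural numbers with sum \<open>n\<close>.\<close>

definition num_partitions :: "nat \<Rightarrow> nat" where
  "num_partitions n = card {N :: nat multiset. 0 \<notin># N \<and> sum_mset N = n}"

definition partition_fps :: "rat fps" where
  "partition_fps = Abs_fps (\<lambda>n. of_nat (num_partitions n))"

text \<open>
  \<open>exp (r log F)\<close>, meaningful for constant term \<open>1\<close>. Since \<^term>\<open>fps_ln 1\<close> is the series
  of \<open>log (1 + X)\<close>, \<open>log F\<close> is obtained by substituting \<open>F - 1\<close>.
\<close>

definition fps_rat_power :: "rat fps \<Rightarrow> rat \<Rightarrow> rat fps" where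
  "fps_rat_power F r = fps_exp 1 oo (fps_const r * (fps_ln 1 oo (F - 1)))"

definition P_coeff :: "rat \<Rightarrow> nat \<Rightarrow> rat" where
  "P_coeff r n = fps_nth (fps_rat_power partition_fps r) n"

text \<open>
  Congruence of rational numbers: \<^const>\<open>quotient_of\<close> gives the reduced fraction \<open>a / b\<close>
  with \<open>b > 0\<close>, which is read as \<open>a b\<^sup>-\<^sup>1\<close> modulo \<open>m\<close>. The denominators being
  invertible modulo \<open>m\<close> is part of the assertion.
\<close>

definition rat_cong :: "rat \<Rightarrow> rat \<Rightarrow> int \<Rightarrow> bool" where
  "rat_cong x y m \<longleftrightarrow>
    (case quotient_of x of (a, b) \<Rightarrow> case quotient_of y of (c, d) \<Rightarrow>
      coprime b m \<and> coprime d m \<and>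
      [a * modular_inverse m b = c * modular_inverse m d] (mod m))"

lemma rat_cong_one_iff:
  assumes "quotient_of x = (a, b)"
  shows "rat_cong x 1 5 \<longleftrightarrow> \<not> 5 dvd b \<and> [a = b] (mod 5)"
proof -
  have cop: "coprime b 5 \<longleftrightarrow> \<not> 5 dvd b"
    using prime_imp_coprime[of "5::int" b] not_coprimeI[of 5 b "5::int"]
    by (auto simp: coprime_commute)
  have "[a * modular_inverse 5 b = 1] (mod 5) \<longleftrightarrow> [a = b] (mod 5)" if "coprime b 5"
  proof -
    have "[a * modular_inverse 5 b = 1] (mod 5) \<longleftrightarrow>
          [a * modular_inverse 5 b = b * modular_inverse 5 b] (mod 5)"
      using cong_modular_inverse1[OF that] cong_sym cong_trans by blast
    also have "\<dots> \<longleftrightarrow> [a = b] (mod 5)"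
      using cong_mult_rcancel[OF coprime_modular_inverse[OF that]] by blast
    finally show ?thesis .
  qed
  then show ?thesis
    using assms cop by (auto simp: rat_cong_def)
qed

lemma rat_cong_zero_iff:
  assumes "quotient_of x = (a, b)"
  shows "rat_cong x 0 5 \<longleftrightarrow> \<not> 5 dvd b \<and> 5 dvd a"
proof -
  have cop: "coprime b 5 \<longleftrightarrow> \<not> 5 dvd b"
    using prime_imp_coprime[of "5::int" b] not_coprimeI[of 5 b "5::int"]
    by (auto simp: coprime_commute)
  have "5 dvd a * modular_inverse 5 b \<longleftrightarrow> 5 dvd a" if "coprime b 5"
    using coprime_modular_inverse[OF that]
    by (simp add: coprime_dvd_mult_left_iff coprime_commute)
  then show ?thesis
    using assms cop by (auto simp: rat_cong_def cong_0_iff)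
qed

end

theory Submission
  imports Defs "HOL-Library.Nat_Bijection" "HOL-Computational_Algebra.Polynomial"
begin

text \<open>
  Write \<open>P\<close> for the partition series and \<open>E = 1 / P\<close>. Since \<open>r = 5 t - 4\<close> with \<open>t\<close> a
  \<open>5\<close>-adic integer, \<open>P\<^sup>r = E\<^sup>4 (P\<^sup>t)\<^sup>5\<close>, and \<open>(P\<^sup>t)\<^sup>5\<close> is modulo \<open>5\<close> a series in \<open>X\<^sup>5\<close>.
  Hence it suffices that the coefficients of \<open>E\<^sup>4 = E E\<^sup>3\<close> at the exponents \<open>5 j + 4\<close> vanish
  modulo \<open>5\<close>. This is Ramanujan's argument: \<open>E\<close> is supported on pentagonal numbers (Euler), \<open>E\<^sup>3\<close> is
  the sum of \<open>(-1)\<^sup>k (2 k + 1) X^(k (k + 1) / 2)\<close> (Jacobi), and a pentagonal number plus the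
  \<open>k\<close>-th triangular number is \<open>4\<close> modulo \<open>5\<close> only if \<open>5\<close> divides \<open>2 k + 1\<close>.
  Both expansions are obtained as limits of finite identities.
\<close>

subsection \<open>Finite forms of the Euler and Jacobi identities\<close>

definition qpoch :: "'a::comm_ring_1 \<Rightarrow> nat \<Rightarrow> 'a" where
  "qpoch q n = (\<Prod>i=1..n. 1 - q ^ i)"

lemma qpoch_0 [simp]: "qpoch q 0 = 1"
  by (simp add: qpoch_def)

lemma qpoch_Suc: "qpoch q (Suc n) = qpoch q n * (1 - q ^ Suc n)"
  by (simp add: qpoch_def)

text \<open>
  Shanks' finite form of the pentagonal number theorem: the sum telescopes into a partial sum of the
  pentagonal series, and its term \<open>s = 0\<close> is \<^term>\<open>qpoch q n\<close>.
\<close>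

definition shanks_sum :: "'a::comm_ring_1 \<Rightarrow> nat \<Rightarrow> 'a" where
  "shanks_sum q n = (\<Sum>s\<le>n. (-1) ^ s * (\<Prod>i\<in>{s<..n}. 1 - q ^ i) * q ^ (s * n + triangle s))"

text \<open>With \<open>a\<close> and \<open>u\<close> as below, the term \<open>s\<close> for
  \<open>Suc n\<close> is \<open>a s - (1 - q ^ s) * a s - u s\<close>, and
  \<open>(1 - q ^ Suc s) * a (Suc s) = - u s\<close>. Summation leaves only \<open>- u n\<close> and
  the new term \<open>s = Suc n\<close>.\<close>

lemma shanks_sum_Suc:
  fixes q :: "'a::comm_ring_1"
  shows "shanks_sum q (Suc n) = shanks_sum q n
    + (-1) ^ Suc n * (q ^ (Suc n * Suc n + triangle n) + q ^ (Suc n * Suc n + triangle (Suc n)))"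
proof -
  define D where "D m s = (\<Prod>i\<in>{s<..m}. 1 - q ^ i)" for m s :: nat
  define a where "a s = (-1) ^ s * D n s * q ^ (s * n + triangle s)" for s
  define u where "u s = (-1) ^ s * D n s * q ^ (s * Suc n + triangle s + Suc n)" for s
  have D_Suc: "D (Suc n) s = (1 - q ^ Suc n) * D n s" if "s \<le> n" for s
  proof -
    have "{s<..Suc n} = insert (Suc n) {s<..n}" using that by auto
    then show ?thesis by (simp add: D_def)
  qed
  have shift: "(1 - q ^ Suc s) * a (Suc s) = - u s" if "s < n" for s
  proof -
    have "{s<..n} = insert (Suc s) {Suc s<..n}" using that by auto
    then have D: "D n s = (1 - q ^ Suc s) * D n (Suc s)" by (simp add: D_def)
    show ?thesis unfolding u_def D by (simp add: a_def algebra_simps power_add)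
  qed
  \<comment> \<open>The term \<open>s = 0\<close> drops out because
    \<open>1 - q ^ 0 = 0\<close>.\<close>
  have "(\<Sum>s\<le>n. (1 - q ^ s) * a s) = (\<Sum>s<n. - u s)"
    by (subst lessThan_Suc_atMost [symmetric], subst sum.lessThan_Suc_shift)
       (simp add: shift del: power_Suc)
  moreover have "(-1) ^ s * D (Suc n) s * q ^ (s * Suc n + triangle s) = a s - (1 - q ^ s) * a s - u s"
    if "s \<le> n" for s
    using that by (simp add: D_Suc a_def u_def algebra_simps power_add)
  then have "shanks_sum q (Suc n) = (\<Sum>s\<le>n. a s - (1 - q ^ s) * a s - u s)
      + (-1) ^ Suc n * q ^ (Suc n * Suc n + triangle (Suc n))"
    by (simp add: shanks_sum_def flip: D_def) (simp add: D_def)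
  ultimately have "shanks_sum q (Suc n) = (\<Sum>s\<le>n. a s) - u n
      + (-1) ^ Suc n * q ^ (Suc n * Suc n + triangle (Suc n))"
    by (simp add: sum_subtractf sum_negf lessThan_Suc_atMost [symmetric])
  then show ?thesis
    by (simp add: shanks_sum_def a_def u_def D_def algebra_simps)
qed

section \<open>Gaussian binomial coefficients and the finite Jacobi identity\<close>

fun gauss_binomial :: "'a::comm_ring_1 \<Rightarrow> nat \<Rightarrow> nat \<Rightarrow> 'a" where
  "gauss_binomial q n 0 = 1"
| "gauss_binomial q 0 (Suc k) = 0"
| "gauss_binomial q (Suc n) (Suc k) = gauss_binomial q n k + q ^ Suc k * gauss_binomial q n (Suc k)"

lemma gauss_binomial_eq_0: "n < k \<Longrightarrow> gauss_binomial q n k = 0"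
  by (induction q n k rule: gauss_binomial.induct) auto

text \<open>The q-Pascal rule and \<open>(1 - q ^ a) + q ^ a * (1 - q ^ b) = 1 - q ^ (a + b)\<close>
  drive an induction on \<open>a + b\<close>. Avoiding division keeps the formula valid in every
  commutative ring.\<close>

lemma gauss_binomial_mult_qpoch:
  "gauss_binomial q (a + b) a * (qpoch q a * qpoch q b) = qpoch q (a + b)"
proof (induction "a + b" arbitrary: a b rule: less_induct)
  case less
  show ?case
  proof (cases a)
    case (Suc a')
    have 1: "gauss_binomial q (a' + b) a' * (qpoch q a' * qpoch q b) = qpoch q (a' + b)"
      using less Suc by simp
    have 2: "gauss_binomial q (a' + b) (Suc a') * (qpoch q (Suc a') * qpoch q b)
        = (1 - q ^ b) * qpoch q (a' + b)"
    proof (cases b)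
      case 0
      then show ?thesis by (simp add: gauss_binomial_eq_0)
    next
      case b: (Suc b')
      have "gauss_binomial q (Suc a' + b') (Suc a') * (qpoch q (Suc a') * qpoch q b') = qpoch q (Suc a' + b')"
        using less(1)[of "Suc a'" b'] Suc b by simp
      then have "gauss_binomial q (Suc a' + b') (Suc a') * (qpoch q (Suc a') * qpoch q b') * (1 - q ^ b)
          = (1 - q ^ b) * qpoch q (a' + b)"
        using b by (simp only: add_Suc add_Suc_right mult.commute)
      then show ?thesis
        unfolding b qpoch_Suc [of q b'] by (simp only: add_Suc add_Suc_right mult.assoc)
    qed
    have "gauss_binomial q (a + b) a * (qpoch q a * qpoch q b) =
       (1 - q ^ Suc a') * (gauss_binomial q (a' + b) a' * (qpoch q a' * qpoch q b)) +
       q ^ Suc a' * (gauss_binomial q (a' + b) (Suc a') * (qpoch q (Suc a') * qpoch q b))"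
      by (simp add: Suc qpoch_Suc algebra_simps)
    also have "\<dots> = (1 - q ^ Suc a') * qpoch q (a' + b) + q ^ Suc a' * ((1 - q ^ b) * qpoch q (a' + b))"
      by (simp only: 1 2)
    also have "\<dots> = qpoch q (a + b)"
      by (simp add: Suc qpoch_Suc algebra_simps power_add)
    finally show ?thesis .
  qed simp
qed

text \<open>The exponent \<open>k choose 2\<close> is written \<^term>\<open>triangle (k - 1)\<close>, which is also right for \<open>k = 0\<close>.\<close>

lemma gauss_binomial_theorem:
  fixes q :: "'a::comm_ring_1"
  shows "(\<Prod>i<n. x + z * q ^ i) =
    (\<Sum>k\<le>n. q ^ triangle (k - 1) * gauss_binomial q n k * x ^ (n - k) * z ^ k)"
proof (induction n arbitrary: z)
  case (Suc n)
  define t where "t m k = q ^ triangle (k - 1) * gauss_binomial q m k * x ^ (m - k) * z ^ k" for m k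
  have q_shift: "q ^ triangle (k - 1) * q ^ k = q ^ triangle k" for k
    by (cases k) (simp_all add: power_add)
  \<comment> \<open>Splitting off the first factor leaves the product for \<open>z * q\<close>,
    hence the induction for arbitrary \<open>z\<close>.\<close>
  have "(\<Prod>i<Suc n. x + z * q ^ i) = (x + z) * (\<Prod>i<n. x + (z * q) * q ^ i)"
    by (simp add: prod.lessThan_Suc_shift mult.assoc del: prod.lessThan_Suc)
  also have "\<dots> = (x + z) * (\<Sum>k\<le>n. t n k * q ^ k)"
    by (subst Suc.IH) (simp add: t_def power_mult_distrib mult_ac)
  also have "\<dots> = (\<Sum>k\<le>n. x * (t n k * q ^ k)) + (\<Sum>k\<le>n. z * (t n k * q ^ k))"
    by (simp add: distrib_right sum_distrib_left sum.distrib)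
  also have "(\<Sum>k\<le>n. x * (t n k * q ^ k)) = x * t n 0 + (\<Sum>k<n. x * (t n (Suc k) * q ^ Suc k))"
    by (subst lessThan_Suc_atMost [symmetric], subst sum.lessThan_Suc_shift) simp
  also have "(\<Sum>k<n. x * (t n (Suc k) * q ^ Suc k)) = (\<Sum>k\<le>n. x * (t n (Suc k) * q ^ Suc k))"
    by (simp add: lessThan_Suc_atMost [symmetric] t_def gauss_binomial_eq_0)
  also have "x * t n 0 + (\<Sum>k\<le>n. x * (t n (Suc k) * q ^ Suc k)) + (\<Sum>k\<le>n. z * (t n k * q ^ k))
      = t (Suc n) 0 + (\<Sum>k\<le>n. x * (t n (Suc k) * q ^ Suc k) + z * (t n k * q ^ k))"
    by (simp add: t_def sum.distrib)
  also have "(\<Sum>k\<le>n. x * (t n (Suc k) * q ^ Suc k) + z * (t n k * q ^ k)) = (\<Sum>k\<le>n. t (Suc n) (Suc k))"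
  proof (rule sum.cong)
    fix k assume "k \<in> {..n}"
    have 1: "x * (t n (Suc k) * q ^ Suc k)
        = q ^ triangle k * (q ^ Suc k * gauss_binomial q n (Suc k)) * x ^ (n - k) * z ^ Suc k"
    proof (cases "k = n")
      case False
      with \<open>k \<in> {..n}\<close> have "n - k = Suc (n - Suc k)" by auto
      then show ?thesis by (simp add: t_def mult_ac)
    qed (simp add: t_def gauss_binomial_eq_0)
    have 2: "z * (t n k * q ^ k) = q ^ triangle k * gauss_binomial q n k * x ^ (n - k) * z ^ Suc k"
      unfolding q_shift [of k, symmetric] by (simp add: t_def mult_ac)
    show "x * (t n (Suc k) * q ^ Suc k) + z * (t n k * q ^ k) = t (Suc n) (Suc k)"
      by (simp only: 1 2) (simp add: t_def algebra_simps)
  qed simp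
  also have "t (Suc n) 0 + (\<Sum>k\<le>n. t (Suc n) (Suc k)) = (\<Sum>k\<le>Suc n. t (Suc n) k)"
    by (simp add: sum.atMost_Suc_shift del: sum.atMost_Suc)
  finally show ?case by (simp only: t_def)
qed simp

lemma triangle_add: "triangle (a + b) = triangle a + triangle b + a * b"
  by (induction b) auto

text \<open>
  Put \<open>x = q\<^sup>n\<close>, \<open>z = - w\<close> in the \<open>q\<close>-binomial theorem of order \<open>2 n + 1\<close> and differentiate at
  \<open>w = 1\<close>, where the middle factor of the product vanishes; the terms \<open>n - k\<close> and \<open>n + 1 + k\<close>
  on the other side carry the same power of \<open>q\<close>.
\<close>

lemma finite_jacobi:
  fixes q :: "'a::idom"
  assumes q: "q \<noteq> 0"
  shows "qpoch q n ^ 2 = (\<Sum>k\<le>n. (-1) ^ k * q ^ triangle k *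
    (of_nat (n + 1 + k) * gauss_binomial q (2 * n + 1) (n + 1 + k)
     - of_nat (n - k) * gauss_binomial q (2 * n + 1) (n - k)))"
proof -
  define N where "N = 2 * n + 1"
  \<comment> \<open>\<open>e\<close> collects \<open>q ^ n\<close> from the derivative of the middle
    factor, \<open>q ^ (n * n)\<close> from the factors \<open>i > n\<close> and
    \<open>q ^ triangle (n - 1)\<close> from the factors \<open>i < n\<close>.\<close>
  define e where "e = n + n * n + triangle (n - 1)"
  define g where "g = gauss_binomial q N"
  define F where "F i = [:q ^ n:] + [:0, -1:] * [:q ^ i:]" for i
  define c where "c j = q ^ triangle (j - 1) * g j * (q ^ n) ^ (N - j)" for j
  define h where "h j = (-1) ^ j * of_nat j * c j" for j
  have gp: "gauss_binomial [:q:] m k = [:gauss_binomial q m k:]" for m k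
    by (induction q m k rule: gauss_binomial.induct) (simp_all add: poly_const_pow algebra_simps one_pCons)
  have z_pow: "[:0, -1:] ^ k = monom ((-1 :: 'a) ^ k) k" for k :: nat
    by (induction k) (simp_all add: monom_Suc minus_monom smult_monom)
  have "(\<Prod>i<N. F i) = (\<Sum>k\<le>N. [:c k:] * [:0, -1:] ^ k)"
    using gauss_binomial_theorem[of "[:q ^ n:]" "[:0, -1:]" "[:q:]" N]
    by (simp add: F_def gp c_def g_def poly_const_pow mult_ac)
  then have eq: "(\<Prod>i<N. F i) = (\<Sum>k\<le>N. monom (c k * (-1) ^ k) k)"
    by (simp add: z_pow smult_monom)
  have "poly (pderiv (\<Prod>i<N. F i)) 1 = (\<Sum>k\<le>N. h k)"
    unfolding eq h_def
    by (induction N) (simp_all add: pderiv_add pderiv_monom poly_monom mult_ac)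
  moreover have "poly (pderiv (\<Prod>i<N. F i)) 1 = - ((-1) ^ n * q ^ e * qpoch q n ^ 2)"
  proof -
    define R where "R = (\<Prod>i\<in>{..<N} - {n}. F i)"
    have "(\<Prod>i<N. F i) = F n * R"
      unfolding R_def by (rule prod.remove) (auto simp: N_def)
    then have "poly (pderiv (\<Prod>i<N. F i)) 1 = - (q ^ n) * poly R 1"
      by (simp only: pderiv_mult) (simp add: F_def pderiv_pCons)
    also have "poly R 1 = (\<Prod>i\<in>{..<N} - {n}. q ^ n - q ^ i)"
      by (simp add: R_def F_def poly_prod)
    also have "{..<N} - {n} = {..<n} \<union> {n<..2 * n}"
      by (auto simp: N_def)
    also have "(\<Prod>i\<in>\<dots>. q ^ n - q ^ i) = (\<Prod>i<n. q ^ n - q ^ i) * (\<Prod>i\<in>{n<..2 * n}. q ^ n - q ^ i)"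
      by (rule prod.union_disjoint) auto
    also have "(\<Prod>i<n. q ^ n - q ^ i) = (\<Prod>i<n. (-1) * q ^ i * (1 - q ^ (n - i)))"
      by (rule prod.cong) (auto simp: algebra_simps simp flip: power_add)
    also have "\<dots> = (-1) ^ n * (\<Prod>i<n. q ^ i) * (\<Prod>i<n. 1 - q ^ (n - i))"
      by (simp only: prod.distrib prod_constant card_lessThan)
    also have "(\<Prod>i<n. q ^ i) = q ^ triangle (n - 1)"
    proof (induction n)
      case (Suc m)
      then show ?case by (cases m) (simp_all add: power_add mult_ac)
    qed simp
    also have "(\<Prod>i<n. 1 - q ^ (n - i)) = qpoch q n"
      unfolding qpoch_def
      by (rule prod.reindex_bij_witness[of _ "\<lambda>i. n - i" "\<lambda>i. n - i"]) auto
    also have "(\<Prod>i\<in>{n<..2 * n}. q ^ n - q ^ i) = (\<Prod>i=1..n. q ^ n * (1 - q ^ i))"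
      by (rule prod.reindex_bij_witness[of _ "\<lambda>i. i + n" "\<lambda>i. i - n"])
         (auto simp: algebra_simps simp flip: power_add)
    also have "\<dots> = q ^ (n * n) * qpoch q n"
      by (simp add: prod.distrib qpoch_def power_mult)
    finally show ?thesis
      by (simp add: e_def power_add power2_eq_square mult_ac)
  qed
  moreover have "(\<Sum>k\<le>N. h k) = (\<Sum>k\<le>n. h (n - k) + h (n + 1 + k))"
  proof -
    have "{..N} = {..n} \<union> {n + 1..N}"
      by (auto simp: N_def)
    then have "(\<Sum>k\<le>N. h k) = (\<Sum>k\<le>n. h k) + (\<Sum>k\<in>{n + 1..N}. h k)"
      by (simp only:) (rule sum.union_disjoint, auto)
    also have "(\<Sum>k\<le>n. h k) = (\<Sum>k\<le>n. h (n - k))"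
      by (rule sum.reindex_bij_witness[of _ "\<lambda>i. n - i" "\<lambda>i. n - i"]) auto
    also have "(\<Sum>k\<in>{n + 1..N}. h k) = (\<Sum>k\<le>n. h (n + 1 + k))"
      by (rule sum.reindex_bij_witness[of _ "\<lambda>i. n + 1 + i" "\<lambda>i. i - (n + 1)"]) (auto simp: N_def)
    finally show ?thesis by (simp add: sum.distrib)
  qed
  moreover have "h (n - k) + h (n + 1 + k) = - ((-1) ^ n * q ^ e) * ((-1) ^ k * q ^ triangle k *
     (of_nat (n + 1 + k) * g (n + 1 + k) - of_nat (n - k) * g (n - k)))" if "k \<le> n" for k
  proof -
    from that obtain m where n: "n = m + k" by (metis le_add_diff_inverse2)
    have tri: "2 * triangle k = k * k + k" by (induction k) auto
    \<comment> \<open>Here \<open>m = n - k\<close>; the case \<open>m = 0\<close> is separate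
      because \<open>m - 1\<close> is then truncated.\<close>
    have 1: "triangle (m - 1) + n * (N - m) = e + triangle k"
    proof (cases m)
      case 0
      with tri show ?thesis
        by (cases k) (auto simp: e_def N_def n)
    next
      case (Suc m')
      with tri show ?thesis
        by (simp add: e_def N_def n triangle_add algebra_simps)
    qed
    have "triangle n = triangle (n - 1) + n"
      by (cases n) auto
    moreover have "n * n = n * m + n * k"
      by (subst (2) n) (rule distrib_left)
    ultimately have 2: "triangle (n + k) + n * m = e + triangle k"
      using triangle_add[of n k] by (simp add: e_def)
    have nk: "n - k = m" and Nk: "N - (n + 1 + k) = m"
      by (simp_all add: n N_def)
    have "c (n - k) = q ^ (triangle (m - 1) + n * (N - m)) * g (n - k)"
      by (simp add: c_def nk power_add power_mult)
    then have "c (n - k) = q ^ e * q ^ triangle k * g (n - k)"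
      by (simp only: 1 power_add)
    moreover have "c (n + 1 + k) = q ^ (triangle (n + k) + n * m) * g (n + 1 + k)"
      by (simp add: c_def Nk [simplified] power_add power_mult)
    then have "c (n + 1 + k) = q ^ e * q ^ triangle k * g (n + 1 + k)"
      by (simp only: 2 power_add)
    moreover have "(-1) ^ (n - k) = (-1 :: 'a) ^ n * (-1) ^ k"
      by (simp add: n power_add flip: power_mult_distrib)
    ultimately show ?thesis
      by (simp add: h_def power_add algebra_simps)
  qed
  ultimately have "((-1) ^ n * q ^ e) * qpoch q n ^ 2 = ((-1) ^ n * q ^ e) *
    (\<Sum>k\<le>n. (-1) ^ k * q ^ triangle k *
      (of_nat (n + 1 + k) * g (n + 1 + k) - of_nat (n - k) * g (n - k)))"
    by (simp add: sum_negf flip: sum_distrib_left)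
  \<comment> \<open>The common factor is cancelled, using \<open>q \<noteq> 0\<close> in an integral
    domain.\<close>
  then show ?thesis
    using q by (simp add: g_def N_def)
qed

subsection \<open>The inverse of the partition series\<close>

text \<open>Congruence modulo \<open>fps_X ^ n\<close>; it carries finite identities to the limit
  without a topology.\<close>

definition fps_agree :: "nat \<Rightarrow> 'a::comm_ring_1 fps \<Rightarrow> 'a fps \<Rightarrow> bool" where
  "fps_agree n f g \<longleftrightarrow> (\<forall>i<n. fps_nth f i = fps_nth g i)"

lemma fps_agree_refl [simp]: "fps_agree n f f"
  by (simp add: fps_agree_def)

lemma fps_agree_sym: "fps_agree n f g \<Longrightarrow> fps_agree n g f"
  by (simp add: fps_agree_def)

lemma fps_agree_trans [trans]: "fps_agree n f g \<Longrightarrow> fps_agree n g h \<Longrightarrow> fps_agree n f h"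
  by (simp add: fps_agree_def)

lemma fps_agree_mono: "fps_agree n f g \<Longrightarrow> m \<le> n \<Longrightarrow> fps_agree m f g"
  by (simp add: fps_agree_def)

lemma fps_agree_diff: "fps_agree n f g \<Longrightarrow> fps_agree n f' g' \<Longrightarrow> fps_agree n (f - f') (g - g')"
  by (simp add: fps_agree_def)

lemma fps_agree_mult: "fps_agree n f g \<Longrightarrow> fps_agree n f' g' \<Longrightarrow> fps_agree n (f * f') (g * g')"
  by (auto simp: fps_agree_def fps_mult_nth intro!: sum.cong)

lemma fps_agree_sum: "(\<And>x. x \<in> A \<Longrightarrow> fps_agree n (f x) (g x)) \<Longrightarrow> fps_agree n (sum f A) (sum g A)"
  by (auto simp: fps_agree_def fps_sum_nth intro!: sum.cong)

lemma fps_agree_X_power_mult: "n \<le> m \<Longrightarrow> fps_agree n (f * fps_X ^ m) 0"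
  by (simp add: fps_agree_def fps_X_power_mult_right_nth)

section \<open>Partitions with bounded parts\<close>

definition bounded_partitions :: "nat \<Rightarrow> nat \<Rightarrow> nat multiset set" where
  "bounded_partitions k n = {N. set_mset N \<subseteq> {1..k} \<and> sum_mset N = n}"

lemma bounded_partitions_0: "bounded_partitions 0 n = (if n = 0 then {{#}} else {})"
  by (auto simp: bounded_partitions_def)

lemma bounded_partitions_Suc:
  "bounded_partitions (Suc k) n = bounded_partitions k n \<union>
     (if Suc k \<le> n then add_mset (Suc k) ` bounded_partitions (Suc k) (n - Suc k) else {})"
  (is "?L = ?A \<union> ?B")
proof (intro equalityI subsetI)
  fix N assume N: "N \<in> ?L"
  show "N \<in> ?A \<union> ?B"
  proof (cases "Suc k \<in># N")
    case True
    then obtain M where M: "N = add_mset (Suc k) M" by (metis mset_add)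
    with N show ?thesis by (auto simp: bounded_partitions_def)
  next
    case False
    have "x \<in> {1..k}" if "x \<in># N" for x
    proof -
      from N that have "x \<in> {1..Suc k}" by (auto simp: bounded_partitions_def)
      moreover from that False have "x \<noteq> Suc k" by auto
      ultimately show ?thesis by auto
    qed
    with N show ?thesis by (auto simp: bounded_partitions_def)
  qed
next
  fix N assume "N \<in> ?A \<union> ?B"
  then show "N \<in> ?L"
    by (auto simp: bounded_partitions_def split: if_splits)
qed

lemma finite_bounded_partitions: "finite (bounded_partitions k n)"
proof (induction k arbitrary: n)
  case (Suc k)
  show ?case
    by (induction n rule: less_induct) (subst bounded_partitions_Suc, simp add: Suc.IH)
qed (simp add: bounded_partitions_0)

lemma card_bounded_partitions_Suc:
  "card (bounded_partitions (Suc k) n) = card (bounded_partitions k n) +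
     (if Suc k \<le> n then card (bounded_partitions (Suc k) (n - Suc k)) else 0)"
proof -
  have "bounded_partitions k n \<inter> add_mset (Suc k) ` M = {}" for M
    by (auto simp: bounded_partitions_def)
  moreover have "card (add_mset (Suc k) ` M) = card M" for M :: "nat multiset set"
    by (rule card_image) (auto simp: inj_on_def)
  ultimately show ?thesis
    by (subst bounded_partitions_Suc) (simp add: card_Un_disjoint finite_bounded_partitions)
qed

text \<open>The recursion for the counts says \<open>G (Suc k) * (1 - fps_X ^ Suc k) = G k\<close>,
  so each new factor of \<open>qpoch\<close> leaves the product unchanged.\<close>

lemma bounded_partitions_fps_mult_qpoch:
  "Abs_fps (\<lambda>n. of_nat (card (bounded_partitions k n))) * qpoch fps_X k = (1 :: 'a::comm_ring_1 fps)"
proof (induction k)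
  case 0
  show ?case by (rule fps_ext) (simp add: bounded_partitions_0)
next
  case (Suc k)
  define G :: "nat \<Rightarrow> 'a fps" where "G k = Abs_fps (\<lambda>n. of_nat (card (bounded_partitions k n)))" for k
  have "G (Suc k) = G k + G (Suc k) * fps_X ^ Suc k"
    by (rule fps_ext)
       (simp only: fps_add_nth fps_X_power_mult_right_nth G_def fps_nth_Abs_fps, subst card_bounded_partitions_Suc, simp)
  then have "G (Suc k) * (1 - fps_X ^ Suc k) = G k"
    by (simp only: right_diff_distrib mult_1_right) (simp only: diff_eq_eq)
  moreover have "G (Suc k) * qpoch fps_X (Suc k) = G (Suc k) * (1 - fps_X ^ Suc k) * qpoch fps_X k"
    by (simp only: qpoch_Suc mult_ac)
  ultimately have "G (Suc k) * qpoch fps_X (Suc k) = G k * qpoch fps_X k"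
    by simp
  then show ?case using Suc by (simp add: G_def)
qed

text \<open>A part of a partition of \<open>n\<close> never exceeds \<open>n\<close>, so the bound
  \<open>k\<close> excludes nothing.\<close>

lemma num_partitions_eq_card_bounded:
  assumes "n \<le> k"
  shows "num_partitions n = card (bounded_partitions k n)"
proof -
  have "0 \<notin># N \<longleftrightarrow> set_mset N \<subseteq> {1..k}" if "sum_mset N = n" for N
  proof
    assume "0 \<notin># N"
    show "set_mset N \<subseteq> {1..k}"
    proof
      fix x assume "x \<in># N"
      then obtain M where "N = add_mset x M" by (metis mset_add)
      then have "x \<le> k" using that assms by simp
      moreover have "x \<noteq> 0" using \<open>x \<in># N\<close> \<open>0 \<notin># N\<close> by metis
      ultimately show "x \<in> {1..k}" by simp
    qed
  qed auto
  then have "{N. 0 \<notin># N \<and> sum_mset N = n} = bounded_partitions k n"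
    unfolding bounded_partitions_def by blast
  then show ?thesis
    by (simp add: num_partitions_def)
qed

section \<open>Euler's and Jacobi's expansions in the limit\<close>

definition euler_fps :: "rat fps" where
  "euler_fps = inverse partition_fps"

lemma partition_fps_nth_0 [simp]: "fps_nth partition_fps 0 = 1"
  by (simp add: partition_fps_def num_partitions_eq_card_bounded[of 0 0] bounded_partitions_0)

lemma partition_fps_mult_euler_fps: "partition_fps * euler_fps = 1"
  unfolding euler_fps_def by (subst mult.commute, rule inverse_mult_eq_1) simp

lemma euler_fps_agree_qpoch: "fps_agree (Suc n) euler_fps (qpoch fps_X n)"
proof -
  have "fps_agree (Suc n) (Abs_fps (\<lambda>i. of_nat (card (bounded_partitions n i)))) partition_fps"
    by (auto simp: fps_agree_def partition_fps_def num_partitions_eq_card_bounded[where k = n])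
  from fps_agree_mult[OF this fps_agree_refl[of _ "qpoch fps_X n"]]
  have "fps_agree (Suc n) 1 (partition_fps * qpoch fps_X n)"
    by (simp add: bounded_partitions_fps_mult_qpoch)
  from fps_agree_mult[OF this fps_agree_refl[of _ euler_fps]]
  have "fps_agree (Suc n) euler_fps ((partition_fps * euler_fps) * qpoch fps_X n)"
    by (simp add: mult_ac)
  then show ?thesis by (simp add: partition_fps_mult_euler_fps)
qed

text \<open>For \<open>s \<ge> 1\<close> the exponent \<open>s * n + triangle s\<close> is at least
  \<open>n + 1\<close>, so only the term \<open>s = 0\<close> is visible.\<close>

lemma shanks_sum_agree_qpoch: "fps_agree (Suc n) (shanks_sum fps_X n) (qpoch fps_X n)"
proof -
  have "shanks_sum fps_X n = qpoch fps_X n + (\<Sum>s=1..n. (-1) ^ s * (\<Prod>i\<in>{s<..n}. 1 - fps_X ^ i) * fps_X ^ (s * n + triangle s) :: 'a fps)"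
  proof -
    have "{..n} = insert 0 {1..n}" "{0<..n} = {1..n}" by auto
    then show ?thesis by (simp add: shanks_sum_def qpoch_def)
  qed
  moreover have "fps_agree (Suc n) (\<Sum>s=1..n. (-1) ^ s * (\<Prod>i\<in>{s<..n}. 1 - fps_X ^ i) * fps_X ^ (s * n + triangle s)) (\<Sum>s=1..n. 0 :: 'a fps)"
  proof (rule fps_agree_sum, rule fps_agree_X_power_mult)
    fix s assume "s \<in> {1..n}"
    then obtain t where "s = Suc t" by (cases s) auto
    then show "Suc n \<le> s * n + triangle s" by simp
  qed
  ultimately show ?thesis
    by (simp add: fps_agree_def)
qed

text \<open>Each step of \<open>shanks_sum_Suc\<close> adds one exponent of either form: the second
  with \<open>k = n\<close>, the first with \<open>k = Suc n\<close>. Together these are the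
  generalized pentagonal numbers.\<close>

lemma shanks_sum_nth_nonzero:
  assumes "fps_nth (shanks_sum (fps_X :: 'a::comm_ring_1 fps) n) i \<noteq> 0"
  shows "\<exists>k. i = k * k + triangle k \<or> i = Suc k * Suc k + triangle k"
  using assms
proof (induction n)
  case 0
  have "shanks_sum (fps_X :: 'a fps) 0 = 1"
    by (simp add: shanks_sum_def)
  with 0 have "i = 0"
    by (simp split: if_splits)
  then show ?case by (intro exI[of _ 0]) simp
next
  case (Suc n)
  have sgn: "(-1 :: 'a fps) ^ Suc n = fps_const ((-1) ^ Suc n)"
    by (simp only: fps_const_power [symmetric] fps_const_neg [symmetric] fps_const_1_eq_1)
  show ?case
  proof (cases "fps_nth (shanks_sum (fps_X :: 'a fps) n) i = 0")
    case True
    have "i = Suc n * Suc n + triangle n \<or> i = Suc n * Suc n + triangle (Suc n)"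
    proof (rule ccontr)
      assume "\<not> ?thesis"
      with True have "fps_nth (shanks_sum (fps_X :: 'a fps) (Suc n)) i = 0"
        by (simp only: shanks_sum_Suc sgn fps_add_nth fps_mult_left_const_nth fps_X_power_nth de_Morgan_disj
              if_False mult_zero_right add_0_right simp_thms)
      with Suc.prems show False by contradiction
    qed
    then show ?thesis by blast
  qed (rule Suc.IH)
qed

lemma euler_fps_nth_nonzero:
  assumes "fps_nth euler_fps i \<noteq> 0"
  shows "\<exists>k. i = k * k + triangle k \<or> i = Suc k * Suc k + triangle k"
proof -
  have "fps_agree (Suc i) euler_fps (shanks_sum fps_X i)"
    using euler_fps_agree_qpoch shanks_sum_agree_qpoch fps_agree_sym fps_agree_trans by blast
  with assms show ?thesis
    using shanks_sum_nth_nonzero by (force simp: fps_agree_def)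
qed

text \<open>In \<open>gauss_binomial_mult_qpoch\<close> all three finite products agree with
  \<open>euler_fps\<close> to order \<open>n\<close>. Multiplication by \<open>partition_fps\<close>
  then cancels one copy on each side.\<close>

lemma euler_fps_mult_gauss_binomial_agree:
  assumes "n \<le> a" "n \<le> b"
  shows "fps_agree n (euler_fps * gauss_binomial fps_X (a + b) a) 1"
proof -
  let ?g = "gauss_binomial fps_X (a + b) a"
  have E: "fps_agree n euler_fps (qpoch fps_X m)" if "n \<le> m" for m
    using euler_fps_agree_qpoch by (rule fps_agree_mono) (use that in simp)
  have "fps_agree n (?g * (euler_fps * euler_fps)) (?g * (qpoch fps_X a * qpoch fps_X b))"
    by (intro fps_agree_mult fps_agree_refl E assms)
  also have "?g * (qpoch fps_X a * qpoch fps_X b) = qpoch fps_X (a + b)"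
    by (rule gauss_binomial_mult_qpoch)
  also have "fps_agree n (qpoch fps_X (a + b)) euler_fps"
    by (intro fps_agree_sym[OF E]) (use assms in simp)
  finally have "fps_agree n (partition_fps * (?g * (euler_fps * euler_fps))) (partition_fps * euler_fps)"
    by (intro fps_agree_mult fps_agree_refl)
  also have "partition_fps * (?g * (euler_fps * euler_fps)) = (partition_fps * euler_fps) * (euler_fps * ?g)"
    by (simp add: mult_ac)
  finally show ?thesis
    by (simp add: partition_fps_mult_euler_fps)
qed

text \<open>When \<open>finite_jacobi\<close> is multiplied by \<open>euler_fps\<close>, both
  q-binomials turn into 1 for small \<open>k\<close>, which leaves the coefficient
  \<open>(m + 1 + k) - (m - k) = 2 * k + 1\<close>.\<close>

lemma euler_fps_cube_agree:
  "fps_agree n (euler_fps ^ 3) (\<Sum>k\<le>2 * n. (-1) ^ k * of_nat (2 * k + 1) * fps_X ^ triangle k)"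
proof -
  \<comment> \<open>This choice keeps the lower index \<open>m - k\<close> at least \<open>n\<close>
    for all \<open>k < n\<close>.\<close>
  define m where "m = 2 * n"
  define g :: "nat \<Rightarrow> rat fps" where "g = gauss_binomial fps_X (2 * m + 1)"
  have "fps_agree n (euler_fps * (euler_fps * euler_fps)) (euler_fps * (qpoch fps_X m * qpoch fps_X m))"
    by (intro fps_agree_mult fps_agree_refl fps_agree_mono[OF euler_fps_agree_qpoch]) (simp_all add: m_def)
  also have "euler_fps * (qpoch fps_X m * qpoch fps_X m) = (\<Sum>k\<le>m. (-1) ^ k * (of_nat (m + 1 + k) * (euler_fps * g (m + 1 + k))
     - of_nat (m - k) * (euler_fps * g (m - k))) * fps_X ^ triangle k)"
    using finite_jacobi[of "fps_X :: rat fps" m]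
    by (simp add: g_def power2_eq_square sum_distrib_left algebra_simps)
  also have "fps_agree n \<dots> (\<Sum>k\<le>m. (-1) ^ k * (of_nat (m + 1 + k) * 1 - of_nat (m - k) * 1) * fps_X ^ triangle k)"
  proof (rule fps_agree_sum)
    fix k assume "k \<in> {..m}"
    show "fps_agree n ((-1) ^ k * (of_nat (m + 1 + k) * (euler_fps * g (m + 1 + k))
        - of_nat (m - k) * (euler_fps * g (m - k))) * fps_X ^ triangle k)
      ((-1) ^ k * (of_nat (m + 1 + k) * 1 - of_nat (m - k) * 1) * fps_X ^ triangle k)"
    \<comment> \<open>For \<open>k \<ge> n\<close> both terms vanish modulo
      \<open>fps_X ^ n\<close>, since \<open>k \<le> triangle k\<close>.\<close>
    proof (cases "n \<le> k")
      case True
      have "k \<le> triangle k" by (cases k) auto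
      with True have "n \<le> triangle k" by simp
      then show ?thesis
        by (meson fps_agree_X_power_mult fps_agree_sym fps_agree_trans)
    next
      case False
      have "m + 1 + k + (m - k) = 2 * m + 1" "m - k + (m + 1 + k) = 2 * m + 1" "n \<le> m - k" "n \<le> m + 1 + k"
        using \<open>k \<in> {..m}\<close> False by (auto simp: m_def)
      then have "fps_agree n (euler_fps * g (m + 1 + k)) 1" "fps_agree n (euler_fps * g (m - k)) 1"
        unfolding g_def by (metis euler_fps_mult_gauss_binomial_agree)+
      then show ?thesis
        by (intro fps_agree_mult fps_agree_diff fps_agree_refl)
    qed
  qed
  also have "(\<Sum>k\<le>m. (-1) ^ k * (of_nat (m + 1 + k) * 1 - of_nat (m - k) * 1) * fps_X ^ triangle k)
      = (\<Sum>k\<le>m. (-1) ^ k * of_nat (2 * k + 1) * fps_X ^ triangle k :: rat fps)"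
    by (rule sum.cong) (simp_all add: of_nat_diff)
  finally show ?thesis by (simp add: power3_eq_cube m_def mult.assoc)
qed

subsection \<open>Rational numbers and power series integral at a prime\<close>

text \<open>For prime \<open>p\<close> this is the localization of the integers at \<open>p\<close>.
  Fractions need not be reduced, which eases the closure proofs.\<close>

definition p_integral :: "nat \<Rightarrow> rat set" where
  "p_integral p = {of_int a / of_int b | a b. \<not> int p dvd b}"

lemma p_integralI: "\<not> int p dvd b \<Longrightarrow> of_int a / of_int b \<in> p_integral p"
  by (auto simp: p_integral_def)

lemma p_integralE:
  assumes "x \<in> p_integral p"
  obtains a b where "x = of_int a / of_int b" "\<not> int p dvd b" "b \<noteq> 0"
  using assms by (auto simp: p_integral_def)

context
  fixes p :: nat
  assumes p: "prime p"
begin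

lemma not_dvd_mult: "\<not> int p dvd a \<Longrightarrow> \<not> int p dvd b \<Longrightarrow> \<not> int p dvd a * b"
  using p by (simp add: prime_dvd_mult_iff)

lemma of_int_p_integral [simp]: "of_int a \<in> p_integral p"
  using p_integralI[of p 1 a] p prime_gt_1_nat[OF p] by simp

lemma of_nat_p_integral [simp]: "of_nat a \<in> p_integral p"
  using of_int_p_integral[of "int a"] by simp

lemma p_integral_0 [simp]: "0 \<in> p_integral p" and p_integral_1 [simp]: "1 \<in> p_integral p"
  using of_int_p_integral[of 0] of_int_p_integral[of 1] by simp_all

lemma p_integral_mult:
  assumes "x \<in> p_integral p" "y \<in> p_integral p"
  shows "x * y \<in> p_integral p"
proof -
  from assms obtain a b c d where "x = of_int a / of_int b" "y = of_int c / of_int d"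
    "\<not> int p dvd b" "\<not> int p dvd d"
    by (auto elim!: p_integralE)
  then show ?thesis
    using p_integralI[of p "b * d" "a * c"] not_dvd_mult by simp
qed

lemma p_integral_add:
  assumes "x \<in> p_integral p" "y \<in> p_integral p"
  shows "x + y \<in> p_integral p"
proof -
  from assms obtain a b c d where "x = of_int a / of_int b" "y = of_int c / of_int d"
    "\<not> int p dvd b" "\<not> int p dvd d" "b \<noteq> 0" "d \<noteq> 0"
    by (auto elim!: p_integralE)
  then show ?thesis
    using p_integralI[of p "b * d" "a * d + c * b"] not_dvd_mult by (simp add: add_frac_eq)
qed

lemma p_integral_uminus: "x \<in> p_integral p \<Longrightarrow> - x \<in> p_integral p"
  using p_integral_mult[of "-1" x] of_int_p_integral[of "-1"] by simp

lemma p_integral_diff: "x \<in> p_integral p \<Longrightarrow> y \<in> p_integral p \<Longrightarrow> x - y \<in> p_integral p"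
  using p_integral_add[OF _ p_integral_uminus] by simp

lemma p_integral_sum: "(\<And>i. i \<in> A \<Longrightarrow> f i \<in> p_integral p) \<Longrightarrow> sum f A \<in> p_integral p"
  by (induction A rule: infinite_finite_induct) (auto intro: p_integral_add)

lemma p_integral_divide: "x \<in> p_integral p \<Longrightarrow> \<not> int p dvd b \<Longrightarrow> x / of_int b \<in> p_integral p"
  using p_integral_mult[OF _ p_integralI[of p b 1]] by simp

text \<open>
  For the \<open>p\<close>-part \<open>q\<close> of \<open>k!\<close>, replace \<open>t\<close> by a natural number \<open>n\<close> congruent to it modulo \<open>q\<close>:
  \<open>n (n - 1) \<dots> (n - k + 1)\<close> is divisible by \<open>k!\<close>, so \<open>q\<close> divides the numerator for \<open>t\<close>.
\<close>

lemma p_integral_gbinomial: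
  assumes "t \<in> p_integral p"
  shows "(t gchoose k) \<in> p_integral p"
proof -
  obtain a b where t: "t = of_int a / of_int b" and b: "\<not> int p dvd b" "b \<noteq> 0"
    using assms by (auto elim!: p_integralE)
  obtain e u where fact: "(fact k :: nat) = p ^ e * u" and u: "\<not> p dvd u"
    by (rule multiplicity_decompose'[where x = "fact k :: nat" and p = p])
       (use p not_prime_unit in auto)
  define q where "q = int p ^ e"
  have "coprime b q"
    using b p prime_imp_coprime[of "int p" b] unfolding q_def by (simp add: coprime_commute)
  then obtain c where c: "[b * c = 1] (mod q)"
    using cong_solve_coprime_int by blast
  have "q > 0"
    using prime_gt_0_nat[OF p] by (simp add: q_def)
  define n where "n = nat (a * c mod q)"
  have n: "[int n = a * c] (mod q)"
    using \<open>q > 0\<close> by (simp add: n_def cong_def)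
  \<comment> \<open>As \<open>c\<close> inverts \<open>b\<close> modulo \<open>q\<close>, the factor
    \<open>c ^ k\<close> turns each \<open>a - i * b\<close> into \<open>n - i\<close> modulo
    \<open>q\<close>; being prime to \<open>q\<close>, it is cancelled afterwards.\<close>
  have "c ^ k * (\<Prod>i<k. a - int i * b) = (\<Prod>i<k. c * (a - int i * b))"
    by (simp add: prod.distrib)
  also have "[\<dots> = (\<Prod>i<k. int n - int i)] (mod q)"
  proof (rule cong_prod)
    fix i
    have "[a * c - int i * (b * c) = int n - int i * 1] (mod q)"
      by (intro cong_diff cong_mult cong_refl c cong_sym[OF n])
    then show "[c * (a - int i * b) = int n - int i] (mod q)"
      by (simp add: algebra_simps)
  qed
  also have "(\<Prod>i<k. int n - int i) = int (fact k * (n choose k))"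
  proof -
    have "rat_of_int (\<Prod>i<k. int n - int i) = fact k * (of_nat n gchoose k)"
      by (simp add: gbinomial_mult_fact lessThan_atLeast0)
    also have "\<dots> = rat_of_int (int (fact k * (n choose k)))"
      by (simp add: binomial_gbinomial)
    finally show ?thesis by (simp only: of_int_eq_iff)
  qed
  finally have "q dvd c ^ k * (\<Prod>i<k. a - int i * b)"
    by (rule cong_dvd_iff[THEN iffD2]) (simp add: fact q_def)
  moreover have "coprime (b * c) q"
    using cong_imp_coprime[OF cong_sym[OF c]] by simp
  then have "coprime q (c ^ k)"
    by (simp add: coprime_commute)
  ultimately have "q dvd (\<Prod>i<k. a - int i * b)"
    using coprime_dvd_mult_right_iff by blast
  then obtain w where w: "(\<Prod>i<k. a - int i * b) = q * w" ..
  have "(t gchoose k) * fact k = (\<Prod>i<k. t - of_nat i)"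
    by (simp add: gbinomial_mult_fact' lessThan_atLeast0)
  also have "\<dots> = (\<Prod>i<k. of_int (a - int i * b) / of_int b)"
    using b by (intro prod.cong) (simp_all add: t field_simps)
  also have "\<dots> = of_int (q * w) / of_int b ^ k"
    by (simp only: w [symmetric] prod_dividef of_int_prod prod_constant card_lessThan)
  finally have "(t gchoose k) * of_nat (p ^ e * u) = of_int (q * w) / of_int b ^ k"
    by (simp only: fact [symmetric] of_nat_fact)
  moreover have "u \<noteq> 0" using u by (cases "u = 0") auto
  \<comment> \<open>The power \<open>p ^ e\<close> cancels, leaving a denominator prime to
    \<open>p\<close>.\<close>
  ultimately have "(t gchoose k) = of_int w / of_int (b ^ k * int u)"
    using b \<open>q > 0\<close> by (auto simp: q_def field_simps)
  moreover have "\<not> int p dvd b ^ k * int u"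
    using b u p prime_dvd_power[of "int p" b k] by (intro not_dvd_mult) auto
  ultimately show ?thesis
    by (metis p_integralI)
qed

end

definition p_integral_fps :: "nat \<Rightarrow> rat fps set" where
  "p_integral_fps p = {f. \<forall>n. fps_nth f n \<in> p_integral p}"

lemma p_integral_fpsD: "f \<in> p_integral_fps p \<Longrightarrow> fps_nth f n \<in> p_integral p"
  by (simp add: p_integral_fps_def)

context
  fixes p :: nat
  assumes p: "prime p"
begin

lemma p_integral_fps_1: "1 \<in> p_integral_fps p"
  using p by (simp add: p_integral_fps_def)

lemma p_integral_fps_mult:
  "f \<in> p_integral_fps p \<Longrightarrow> g \<in> p_integral_fps p \<Longrightarrow> f * g \<in> p_integral_fps p"
  using p by (auto simp: p_integral_fps_def fps_mult_nth intro!: p_integral_sum p_integral_mult)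

lemma p_integral_fps_power: "f \<in> p_integral_fps p \<Longrightarrow> f ^ n \<in> p_integral_fps p"
  by (induction n) (auto intro: p_integral_fps_1 p_integral_fps_mult)

lemma p_integral_fps_compose:
  "f \<in> p_integral_fps p \<Longrightarrow> g \<in> p_integral_fps p \<Longrightarrow> f oo g \<in> p_integral_fps p"
  unfolding p_integral_fps_def [of p]
  by (auto simp: fps_compose_nth intro!: p_integral_sum[OF p] p_integral_mult[OF p]
      p_integral_fpsD[OF p_integral_fps_power] simp: p_integral_fps_def)

text \<open>Since \<open>(f\<^sup>p)' = p f\<^sup>p\<^sup>-\<^sup>1 f'\<close>, the series \<open>f\<^sup>p\<close> is modulo \<open>p\<close> a series in \<open>X\<^sup>p\<close>.\<close>

lemma p_integral_fps_power_p_nth: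
  assumes "f \<in> p_integral_fps p" "\<not> p dvd n"
  shows "fps_nth (f ^ p) n / of_nat p \<in> p_integral p"
proof -
  obtain m where n: "n = Suc m"
    using assms(2) by (cases n) auto
  have "fps_deriv f \<in> p_integral_fps p"
    using assms(1) p by (simp add: p_integral_fps_def p_integral_mult flip: of_nat_Suc)
  then have int: "fps_deriv f * f ^ (p - 1) \<in> p_integral_fps p"
    using assms(1) by (intro p_integral_fps_mult p_integral_fps_power)
  \<comment> \<open>The derivative exhibits \<open>n\<close> times the coefficient as a multiple of
    \<open>p\<close>, and \<open>n\<close> is invertible at \<open>p\<close>.\<close>
  have "of_nat n * fps_nth (f ^ p) n = fps_nth (fps_deriv (f ^ p)) m"
    by (simp add: n)
  also have "\<dots> = of_nat p * fps_nth (fps_deriv f * f ^ (p - 1)) m"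
    by (simp only: fps_deriv_power' fps_of_nat [symmetric] mult.assoc fps_mult_left_const_nth)
  finally have "fps_nth (f ^ p) n / of_nat p = fps_nth (fps_deriv f * f ^ (p - 1)) m / of_int (int n)"
    using prime_gt_0_nat[OF p] by (simp add: n field_simps)
  also have "\<dots> \<in> p_integral p"
    using p assms(2) by (intro p_integral_divide p_integral_fpsD[OF int]) auto
  finally show ?thesis .
qed

end

section \<open>Rational powers as binomial series\<close>

lemma fps_exp_compose_fps_ln:
  "fps_exp 1 oo (fps_const c * fps_ln 1) = (fps_binomial c :: 'a::field_char_0 fps)"
proof -
  let ?f = "fps_exp 1 oo (fps_const c * fps_ln 1) :: 'a fps"
  \<comment> \<open>Together with constant term 1, this differential equation characterises the
    binomial series.\<close>
  have "fps_deriv ?f = ?f * (fps_const c * inverse (1 + fps_X))"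
    by (simp add: fps_compose_deriv fps_ln_deriv)
  also have "\<dots> = fps_const c * ?f / (1 + fps_X)"
    by (simp add: fps_divide_unit mult_ac)
  finally show ?thesis
    by (simp flip: fps_binomial_ODE_unique')
qed

text \<open>As \<open>F - 1\<close> has constant term 0, the substitutions associate. Powers are
  thus governed by the coefficients \<open>r gchoose k\<close>.\<close>

lemma fps_rat_power_eq_compose:
  assumes "fps_nth F 0 = 1"
  shows "fps_rat_power F r = fps_binomial r oo (F - 1)"
proof -
  have "fps_binomial r oo (F - 1) = fps_exp 1 oo ((fps_const r * fps_ln 1) oo (F - 1))"
    unfolding fps_exp_compose_fps_ln [symmetric] by (rule fps_compose_assoc [symmetric]) (simp_all add: assms)
  then show ?thesis
    by (simp add: fps_rat_power_def fps_const_mult_apply_left)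
qed

text \<open>The exponent laws of the binomial series survive the substitution of
  \<open>F - 1\<close>.\<close>

lemma fps_rat_power_split:
  assumes F: "fps_nth F 0 = 1" and r: "r + of_nat m = of_nat n * t"
  shows "fps_rat_power F r * F ^ m = fps_rat_power F t ^ n"
proof -
  have X: "(1 + fps_X) oo (F - 1) = F"
    using F by (simp add: fps_compose_add_distrib)
  have "fps_binomial r * (1 + fps_X) ^ m = fps_binomial t ^ n"
    by (simp only: fps_binomial_of_nat [symmetric] fps_binomial_add_mult [symmetric] fps_binomial_power r)
  then have "(fps_binomial r * (1 + fps_X) ^ m) oo (F - 1) = fps_binomial t ^ n oo (F - 1)"
    by simp
  then show ?thesis
    using F by (simp add: fps_rat_power_eq_compose fps_compose_mult_distrib fps_compose_power [symmetric] X)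
qed

lemma fps_rat_power_p_integral:
  assumes p: "prime p" and F: "fps_nth F 0 = 1" "F \<in> p_integral_fps p" and "t \<in> p_integral p"
  shows "fps_rat_power F t \<in> p_integral_fps p"
proof -
  have "F - 1 \<in> p_integral_fps p"
    using F p by (simp add: p_integral_fps_def p_integral_diff)
  moreover have "fps_binomial t \<in> p_integral_fps p"
    using assms by (simp add: p_integral_fps_def p_integral_gbinomial)
  ultimately show ?thesis
    using p F by (simp add: fps_rat_power_eq_compose p_integral_fps_compose)
qed

text \<open>From \<open>x = a / b\<close> and \<open>x / 5 = c / d\<close> follows
  \<open>a * d = 5 * (c * b)\<close>, so 5 divides \<open>a\<close>; the fraction being reduced, 5
  does not divide \<open>b\<close>.\<close>

lemma rat_cong_0_5I:
  assumes "x / 5 \<in> p_integral 5"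
  shows "rat_cong x 0 5"
proof -
  obtain a b where ab: "quotient_of x = (a, b)" by fastforce
  then have x: "x = of_int a / of_int b" and "coprime a b" "b > 0"
    by (auto dest: quotient_of_div quotient_of_coprime quotient_of_denom_pos)
  obtain c d where cd: "x / 5 = of_int c / of_int d" "\<not> 5 dvd d" "d \<noteq> 0"
    using assms by (auto elim!: p_integralE)
  with \<open>b > 0\<close> have "rat_of_int (a * d) = rat_of_int (5 * (c * b))"
    unfolding x by (simp add: field_simps)
  then have "a * d = 5 * (c * b)"
    by (simp only: of_int_eq_iff)
  then have "5 dvd a * d" by simp
  then have "5 dvd a"
    using cd prime_dvd_mult_iff[of "5 :: int"] by simp
  moreover from this \<open>coprime a b\<close> have "\<not> 5 dvd b"
    using coprime_common_divisor[of a b 5] by auto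
  ultimately show ?thesis
    by (simp add: rat_cong_zero_iff[OF ab])
qed

text \<open>For \<open>r = a / b\<close> the congruence of \<open>a\<close> and \<open>b\<close>
  makes \<open>a + 4 * b\<close> a multiple of 5. The quotient is the \<open>t\<close> of the
  decomposition \<open>r = 5 * t - 4\<close>.\<close>

lemma rat_cong_1_5D:
  assumes "rat_cong r 1 5"
  shows "(r + 4) / 5 \<in> p_integral 5"
proof -
  obtain a b where ab: "quotient_of r = (a, b)" by fastforce
  with assms have b: "\<not> 5 dvd b" and "[a = b] (mod 5)"
    by (simp_all add: rat_cong_one_iff)
  then have "5 dvd a + 4 * b"
    unfolding cong_def by presburger
  then obtain c where "a + 4 * b = 5 * c" ..
  then have "rat_of_int a + 4 * of_int b = 5 * of_int c"
    by (metis of_int_add of_int_mult of_int_numeral)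
  moreover from b have "b \<noteq> 0" by auto
  ultimately have "(r + 4) / 5 = of_int c / of_int b"
    using quotient_of_div[OF ab] by (simp add: field_simps)
  then show ?thesis
    using b p_integralI[of 5 b c] by simp
qed

subsection \<open>Congruences modulo 5\<close>

lemma qpoch_X_p_integral:
  assumes "prime p"
  shows "qpoch fps_X n \<in> p_integral_fps p"
proof (induction n)
  case (Suc n)
  have "1 - fps_X ^ Suc n \<in> p_integral_fps p"
    using assms by (simp add: p_integral_fps_def p_integral_diff del: power_Suc)
  with Suc show ?case
    unfolding qpoch_Suc by (rule p_integral_fps_mult[OF assms])
qed (simp add: p_integral_fps_1 assms)

lemma euler_fps_p_integral:
  assumes "prime p"
  shows "euler_fps \<in> p_integral_fps p"
  unfolding p_integral_fps_def
proof (intro CollectI allI)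
  fix n
  have "fps_nth euler_fps n = fps_nth (qpoch fps_X n) n"
    using euler_fps_agree_qpoch[of n] by (simp add: fps_agree_def)
  then show "fps_nth euler_fps n \<in> p_integral p"
    using p_integral_fpsD[OF qpoch_X_p_integral[OF assms]] by simp
qed

lemma euler_fps_cube_nth:
  "fps_nth (euler_fps ^ 3) j =
    (\<Sum>k\<le>2 * Suc j. if j = triangle k then (-1) ^ k * of_nat (2 * k + 1) else 0)"
proof -
  have c: "(-1) ^ k * of_nat (2 * k + 1) = fps_const ((-1 :: rat) ^ k * of_nat (2 * k + 1))" for k :: nat
    by (simp only: fps_const_mult [symmetric] fps_const_power [symmetric] fps_const_neg [symmetric]
          fps_const_1_eq_1 fps_of_nat)
  have "fps_nth (euler_fps ^ 3) j
      = fps_nth (\<Sum>k\<le>2 * Suc j. (-1) ^ k * of_nat (2 * k + 1) * fps_X ^ triangle k) j"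
    using euler_fps_cube_agree[of "Suc j"] unfolding fps_agree_def by (metis lessI)
  also have "\<dots> = (\<Sum>k\<le>2 * Suc j. if j = triangle k then (-1) ^ k * of_nat (2 * k + 1) else 0)"
    unfolding c fps_sum_nth fps_mult_left_const_nth fps_X_power_nth by (rule sum.cong) auto
  finally show ?thesis .
qed

text \<open>
  With \<open>i\<close> pentagonal and \<open>j\<close> the \<open>l\<close>-th triangular number, \<open>24 (i + j) + 4\<close> has the
  form \<open>x\<^sup>2 + 3 (2 l + 1)\<^sup>2\<close>, and \<open>-3\<close> is not a square modulo \<open>5\<close>.
\<close>

lemma pentagonal_plus_triangle_mod_5:
  assumes i: "i = k * k + triangle k \<or> i = Suc k * Suc k + triangle k"
    and ij: "(i + triangle l) mod 5 = 4"
  shows "5 dvd 2 * l + 1"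
proof -
  \<comment> \<open>Doubling clears the denominators of triangular numbers and turns the residue 4
    into 3.\<close>
  have tri: "2 * triangle k = k * k + k" for k by (induction k) auto
  define a b where "a = k mod 5" and "b = l mod 5"
  have ab: "a \<in> {0, 1, 2, 3, 4}" "b \<in> {0, 1, 2, 3, 4}" unfolding a_def b_def by auto
  have "2 * (i + triangle l) = 3 * (k * k) + k + (l * l + l) \<or>
        2 * (i + triangle l) = 3 * (k * k) + 5 * k + 2 + (l * l + l)"
    using i tri[of k] tri[of l] by auto
  moreover have "2 * (i + triangle l) mod 5 = 3"
    using ij by presburger
  ultimately have "(3 * (k * k) + k + (l * l + l)) mod 5 = 3 \<or> (3 * (k * k) + 5 * k + 2 + (l * l + l)) mod 5 = 3"
    by metis
  moreover have "[3 * (k * k) + k + (l * l + l) = 3 * (a * a) + a + (b * b + b)] (mod 5)"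
    "[3 * (k * k) + 5 * k + 2 + (l * l + l) = 3 * (a * a) + 5 * a + 2 + (b * b + b)] (mod 5)"
    unfolding a_def b_def by (intro cong_add cong_mult cong_refl; simp add: cong_def)+
  ultimately have "(3 * (a * a) + a + (b * b + b)) mod 5 = 3 \<or> (3 * (a * a) + 5 * a + 2 + (b * b + b)) mod 5 = 3"
    by (simp add: cong_def)
  \<comment> \<open>All 25 residue pairs are checked.\<close>
  with ab have "b = 2" by auto
  then show ?thesis
    unfolding b_def by presburger
qed

lemma euler_fps_power_4_nth:
  assumes "n mod 5 = 4"
  shows "fps_nth (euler_fps ^ 4) n / 5 \<in> p_integral 5"
proof -
  have p: "prime (5 :: nat)" by simp
  have "euler_fps ^ 4 = euler_fps * euler_fps ^ 3"
    by (simp add: eval_nat_numeral)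
  then have "fps_nth (euler_fps ^ 4) n / 5
      = (\<Sum>i = 0..n. fps_nth euler_fps i * (fps_nth (euler_fps ^ 3) (n - i) / 5))"
    by (simp add: fps_mult_nth sum_divide_distrib)
  also have "\<dots> \<in> p_integral 5"
  proof (rule p_integral_sum[OF p])
    fix i assume "i \<in> {0..n}"
    show "fps_nth euler_fps i * (fps_nth (euler_fps ^ 3) (n - i) / 5) \<in> p_integral 5"
    proof (cases "fps_nth euler_fps i = 0")
      case True
      then show ?thesis by simp
    next
      case False
      then obtain k where k: "i = k * k + triangle k \<or> i = Suc k * Suc k + triangle k"
        using euler_fps_nth_nonzero by blast
      \<comment> \<open>A summand is nonzero only if \<open>n - i = triangle l\<close>; since
        \<open>i\<close> is pentagonal and \<open>i + triangle l = n\<close>, 5 divides its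
        coefficient \<open>2 * l + 1\<close>.\<close>
      have "(\<Sum>l\<le>2 * Suc (n - i). (if n - i = triangle l then (-1) ^ l * of_nat (2 * l + 1) else 0) / 5)
          \<in> p_integral 5"
      proof (rule p_integral_sum[OF p])
        fix l
        show "(if n - i = triangle l then (-1) ^ l * of_nat (2 * l + 1) else 0) / 5 \<in> p_integral 5"
        proof (cases "n - i = triangle l")
          case True
          then have "i + triangle l = n" using \<open>i \<in> {0..n}\<close> by simp
          then have "5 dvd 2 * l + 1"
            using pentagonal_plus_triangle_mod_5[OF k] assms by simp
          then obtain c where "2 * l + 1 = 5 * c" ..
          then have eq: "(-1) ^ l * of_nat (2 * l + 1) / 5 = (of_int ((-1) ^ l * int c) :: rat)"
            by simp
          show ?thesis
            unfolding if_P[OF True] eq by (rule of_int_p_integral[OF p])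
        qed simp
      qed
      then have "fps_nth (euler_fps ^ 3) (n - i) / 5 \<in> p_integral 5"
        by (simp only: euler_fps_cube_nth sum_divide_distrib)
      then show ?thesis
        using p_integral_mult[OF p] p_integral_fpsD[OF euler_fps_p_integral[OF p]] by blast
    qed
  qed
  finally show ?thesis .
qed

theorem mainTheorem2:
  fixes r :: rat and m :: nat
  assumes "rat_cong r 1 5"
  shows "rat_cong (P_coeff r (5 * m + 4)) 0 5"
proof (rule rat_cong_0_5I)
  have p: "prime (5 :: nat)" by simp
  define t where "t = (r + 4) / 5"
  define H where "H = fps_rat_power partition_fps t"
  let ?n = "5 * m + 4"
  have "partition_fps \<in> p_integral_fps 5"
    by (simp add: p_integral_fps_def partition_fps_def)
  then have H: "H \<in> p_integral_fps 5"
    unfolding H_def t_def using rat_cong_1_5D[OF assms]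
    by (intro fps_rat_power_p_integral) simp_all
  have "r + of_nat 4 = of_nat 5 * t"
    by (simp add: t_def)
  then have "fps_rat_power partition_fps r * partition_fps ^ 4 = H ^ 5"
    unfolding H_def by (intro fps_rat_power_split) simp_all
  then have "fps_rat_power partition_fps r * (partition_fps * euler_fps) ^ 4 = euler_fps ^ 4 * H ^ 5"
    by (simp add: power_mult_distrib mult_ac)
  then have "P_coeff r ?n / 5 = (\<Sum>i = 0..?n. fps_nth (euler_fps ^ 4) i * fps_nth (H ^ 5) (?n - i) / 5)"
    by (simp add: P_coeff_def partition_fps_mult_euler_fps fps_mult_nth sum_divide_distrib)
  also have "\<dots> \<in> p_integral 5"
  proof (rule p_integral_sum[OF p])
    fix i assume i: "i \<in> {0..?n}"
    show "fps_nth (euler_fps ^ 4) i * fps_nth (H ^ 5) (?n - i) / 5 \<in> p_integral 5"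
    \<comment> \<open>If \<open>i\<close> is 4 modulo 5, the coefficient of
      \<open>euler_fps ^ 4\<close> supplies the factor 5; otherwise \<open>?n - i\<close> is prime
      to 5 and the coefficient of \<open>H ^ 5\<close> does.\<close>
    proof (cases "i mod 5 = 4")
      case True
      from p_integral_mult[OF p euler_fps_power_4_nth[OF True]
          p_integral_fpsD[OF p_integral_fps_power[OF p H]]]
      show ?thesis by simp
    next
      case False
      with i have "\<not> 5 dvd ?n - i"
        by simp presburger
      from p_integral_mult[OF p p_integral_fpsD[OF p_integral_fps_power[OF p euler_fps_p_integral[OF p]]]
          p_integral_fps_power_p_nth[OF p H this]]
      show ?thesis by simp
    qed
  qed
  finally show "P_coeff r ?n / 5 \<in> p_integral 5" .
qed

end
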